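(* For any integer $p\ge3$, $$\mathcal{M}^{\mathrm{EE}}_p(\{0\})\le\frac{\left(\frac1{W(1/e)}\right)^p}{2\pi\sqrt{p-1}}<\frac{3.592^p}{2\pi\sqrt{p-1}}.$$
   Context: Explicit Euler (EE) extrapolation of order $p\ge2$ on the test equation $U'=\lambda U$, with $z=\tau\lambda\in\mathbb{C}$ and internal perturbations: given $U_n$ and residuals $\tilde r_{m,j}\in\mathbb{C}$ ($1\le m\le p$, $1\le j\le m$), set $$\widetilde Y_{m,0}=U_n,\qquad \widetilde Y_{m,j}=\Big(1+\frac zm\Big)\widetilde Y_{m,j-1}+\tilde r_{m,j}\ (1\le j\le m),\qquad T_{m,1}=\widetilde Y_{m,m},$$ $$T_{j,k}=T_{j,k-1}+\frac{T_{j,k-1}-T_{j-1,k-1}}{\frac{j}{j-k+1}-1}\quad(2\le k\le j\le p),\qquad U_{n+1}=T_{p,p}.$$ Then $U_{n+1}=P(z)U_n+\sum_{m=1}^p\sum_{\ell=1}^mQ^{\mathrm{EE}}_{p,m,\ell}(z)\,\tilde r_{m,\ell}$, which defines the internal stability polynomials $Q^{\mathrm{EE}}_{p,m,\ell}$. For $\mathcal{S}\subset\mathbb{C}$, $$\mathcal{M}^{\mathrm{EE}}_p(\mathcal{S}):=\max_{1\le m\le p}\max_{1\le\ell\le m}\sup_{z\in\mathcal{S}}|Q^{\mathrm{EE}}_{p,m,\ell}(z)|,$$ so that $\mathcal{M}^{\mathrm{EE}}_p(\{0\})=\max_{m,\ell}|Q^{\mathrm{EE}}_{p,m,\ell}(0)|$.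 $W$ is the Lambert function: for $x\ge-1/e$, $W(x)\ge-1$ is the unique number with $W(x)e^{W(x)}=x$. *)

theory Defs
  imports "HOL-Analysis.Analysis" "HOL-Computational_Algebra.Polynomial"
begin

text \<open>One step of explicit Euler extrapolation on \<open>U' = \<lambda> U\<close> with \<open>z = \<tau> \<lambda>\<close>,
  starting value \<open>u = U\<^sub>n\<close> and internal perturbations \<open>r m j\<close>, which are relevant only
  for \<open>1 \<le> j \<le> m\<close>.\<close>

primrec ee_stage :: "complex \<Rightarrow> complex \<Rightarrow> (nat \<Rightarrow> nat \<Rightarrow> complex) \<Rightarrow> nat \<Rightarrow> nat \<Rightarrow> complex" where
  "ee_stage z u r m 0 = u"
| "ee_stage z u r m (Suc j) = (1 + z / of_nat m) * ee_stage z u r m j + r m (Suc j)"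

text \<open>The extrapolation tableau \<open>T\<^bsub>j,k\<^esub>\<close> is meaningful for \<open>1 \<le> k \<le> j\<close>; the other
  values, including the column \<open>k = 0\<close>, are never used.\<close>

fun ee_tableau :: "complex \<Rightarrow> complex \<Rightarrow> (nat \<Rightarrow> nat \<Rightarrow> complex) \<Rightarrow> nat \<Rightarrow> nat \<Rightarrow> complex" where
  "ee_tableau z u r j k =
    (if k \<le> 1 then ee_stage z u r j j
     else ee_tableau z u r j (k - 1)
       + (ee_tableau z u r j (k - 1) - ee_tableau z u r (j - 1) (k - 1))
         / (of_nat j / (of_nat j - of_nat k + 1) - 1))"

declare ee_tableau.simps [simp del]

definition ee_step :: "nat \<Rightarrow> complex \<Rightarrow> complex \<Rightarrow> (nat \<Rightarrow> nat \<Rightarrow> complex) \<Rightarrow> complex" where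
  "ee_step p z u r = ee_tableau z u r p p"

definition ee_decomposition :: "nat \<Rightarrow> complex poly \<Rightarrow> (nat \<Rightarrow> nat \<Rightarrow> complex poly) \<Rightarrow> bool" where
  "ee_decomposition p P Q \<longleftrightarrow>
    (\<forall>z u r. ee_step p z u r =
       poly P z * u + (\<Sum>m=1..p. \<Sum>l=1..m. poly (Q m l) z * r m l))"

text \<open>The internal stability polynomials are read off from the decomposition. Existence and
  uniqueness for \<open>1 \<le> l \<le> m \<le> p\<close> are shown in \<open>ee_decomposition_exists\<close> and
  \<open>ee_internal_poly_eq\<close>.\<close>

definition ee_internal_poly :: "nat \<Rightarrow> nat \<Rightarrow> nat \<Rightarrow> complex poly" where
  "ee_internal_poly p m l = (THE q. \<exists>P Q. ee_decomposition p P Q \<and> q = Q m l)"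

text \<open>Extended-real valued, since the supremum over an unbounded set may be infinite.\<close>

definition ee_amplification :: "nat \<Rightarrow> complex set \<Rightarrow> ereal" where
  "ee_amplification p S =
    (MAX m\<in>{1..p}. MAX l\<in>{1..m}. SUP z\<in>S. ereal (norm (poly (ee_internal_poly p m l) z)))"

text \<open>Principal real branch; well-defined for \<open>x \<ge> -1/e\<close> by \<open>lambert_W_ex1\<close>.\<close>

definition lambert_W :: "real \<Rightarrow> real" where
  "lambert_W x = (THE w. w \<ge> -1 \<and> w * exp w = x)"


lemma ee_decomposition_unique:
  assumes "ee_decomposition p P Q" "ee_decomposition p P' Q'" "m \<in> {1..p}" "l \<in> {1..m}"
  shows "Q m l = Q' m l"
proof -
  have coeff: "poly (R m l) z = ee_step p z 0 (\<lambda>i j. if i = m \<and> j = l then 1 else 0)"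
    if d: "ee_decomposition p P R" for P R z
  proof -
    have "(\<Sum>i=1..p. \<Sum>j=1..i. poly (R i j) z * (if i = m \<and> j = l then 1 else 0))
        = (\<Sum>i=1..p. if i = m then \<Sum>j=1..i. (if j = l then poly (R i j) z else 0) else 0)"
      by (intro sum.cong refl) (auto intro!: sum.cong simp del: sum.delta sum.delta')
    also have "\<dots> = (\<Sum>j=1..m. if j = l then poly (R m j) z else 0)"
      using assms(3) by (simp add: sum.delta')
    also have "\<dots> = poly (R m l) z"
      using assms(4) by (simp add: sum.delta')
    finally show ?thesis
      using d[unfolded ee_decomposition_def, rule_format,
          of z 0 "\<lambda>i j. if i = m \<and> j = l then 1 else 0"] by simp
  qed
  show ?thesis
    using coeff[OF assms(1)] coeff[OF assms(2)] by (simp add: poly_eq_poly_eq_iff[symmetric] fun_eq_iff)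
qed

lemma ee_internal_poly_eq:
  assumes "ee_decomposition p P Q" "m \<in> {1..p}" "l \<in> {1..m}"
  shows "ee_internal_poly p m l = Q m l"
  unfolding ee_internal_poly_def
proof (rule the_equality)
  show "\<exists>P' Q'. ee_decomposition p P' Q' \<and> Q m l = Q' m l"
    using assms(1) by (intro exI[of _ P] exI[of _ Q]) simp
next
  fix q assume "\<exists>P' Q'. ee_decomposition p P' Q' \<and> q = Q' m l"
  then obtain P' Q' where "ee_decomposition p P' Q'" "q = Q' m l" by metis
  then show "q = Q m l"
    using ee_decomposition_unique[OF _ assms] by simp
qed

definition ee_affine :: "nat \<Rightarrow> (complex \<Rightarrow> complex \<Rightarrow> (nat \<Rightarrow> nat \<Rightarrow> complex) \<Rightarrow> complex) \<Rightarrow> bool" where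
  "ee_affine p f \<longleftrightarrow> (\<exists>P Q. \<forall>z u r. f z u r =
     poly P z * u + (\<Sum>m=1..p. \<Sum>l=1..m. poly (Q m l) z * r m l))"

lemma ee_affine_start: "ee_affine p (\<lambda>z u r. u)"
  unfolding ee_affine_def by (rule exI[of _ 1], rule exI[of _ "\<lambda>_ _. 0"]) simp

lemma ee_affine_residual:
  assumes "m \<in> {1..p}" "l \<in> {1..m}"
  shows "ee_affine p (\<lambda>z u r. r m l)"
proof -
  have "r m l = poly 0 z * u
      + (\<Sum>i=1..p. \<Sum>j=1..i. poly (if i = m \<and> j = l then 1 else 0) z * r i j)" for z u :: complex and r
  proof -
    have "(\<Sum>i=1..p. \<Sum>j=1..i. poly (if i = m \<and> j = l then 1 else 0) z * r i j)
        = (\<Sum>i=1..p. if i = m then \<Sum>j=1..i. (if j = l then r i j else 0) else 0)"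
      by (intro sum.cong refl) (auto intro!: sum.cong simp del: sum.delta sum.delta')
    also have "\<dots> = (\<Sum>j=1..m. if j = l then r m j else 0)"
      using assms(1) by (simp add: sum.delta')
    also have "\<dots> = r m l"
      using assms(2) by (simp add: sum.delta')
    finally show ?thesis by simp
  qed
  note rep = this
  show ?thesis
    unfolding ee_affine_def
    by (rule exI[of _ 0], rule exI[of _ "\<lambda>i j. if i = m \<and> j = l then 1 else 0"],
        intro allI, rule rep)
qed

lemma ee_affine_add:
  assumes "ee_affine p f" "ee_affine p g"
  shows "ee_affine p (\<lambda>z u r. f z u r + g z u r)"
proof -
  from assms(1) obtain P Q where f:
    "\<And>z u r. f z u r = poly P z * u + (\<Sum>m=1..p. \<Sum>l=1..m. poly (Q m l) z * r m l)"
    unfolding ee_affine_def by blast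
  from assms(2) obtain P' Q' where g:
    "\<And>z u r. g z u r = poly P' z * u + (\<Sum>m=1..p. \<Sum>l=1..m. poly (Q' m l) z * r m l)"
    unfolding ee_affine_def by blast
  show ?thesis
    unfolding ee_affine_def f g
    by (rule exI[of _ "P + P'"], rule exI[of _ "\<lambda>m l. Q m l + Q' m l"])
       (simp add: distrib_right sum.distrib)
qed

lemma ee_affine_mult:
  assumes "ee_affine p f"
  shows "ee_affine p (\<lambda>z u r. poly a z * f z u r)"
proof -
  from assms obtain P Q where f:
    "\<And>z u r. f z u r = poly P z * u + (\<Sum>m=1..p. \<Sum>l=1..m. poly (Q m l) z * r m l)"
    unfolding ee_affine_def by blast
  show ?thesis
    unfolding ee_affine_def f
    by (rule exI[of _ "a * P"], rule exI[of _ "\<lambda>m l. a * Q m l"])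
       (simp add: distrib_left sum_distrib_left mult.assoc)
qed

lemma ee_affine_stage:
  assumes "m \<in> {1..p}" "j \<le> m"
  shows "ee_affine p (\<lambda>z u r. ee_stage z u r m j)"
  using assms(2)
proof (induction j)
  case 0
  then show ?case by (simp add: ee_affine_start)
next
  case (Suc j)
  have "ee_affine p (\<lambda>z u r. poly [:1, 1 / of_nat m:] z * ee_stage z u r m j + r m (Suc j))"
    using Suc assms(1) by (intro ee_affine_add ee_affine_mult ee_affine_residual) auto
  then show ?case by simp
qed

lemma ee_affine_tableau:
  assumes "1 \<le> k" "k \<le> j" "j \<le> p"
  shows "ee_affine p (\<lambda>z u r. ee_tableau z u r j k)"
  using assms
proof (induction k arbitrary: j rule: nat_induct_at_least)
  case base
  then show ?case
    by (subst ee_tableau.simps) (simp add: ee_affine_stage)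
next
  case (Suc k)
  define c :: complex where "c = 1 / (of_nat j / (of_nat j - of_nat (Suc k) + 1) - 1)"
  have "ee_affine p (\<lambda>z u r. poly [:1 + c:] z * ee_tableau z u r j k
      + poly [:-c:] z * ee_tableau z u r (j - 1) k)"
    using Suc by (intro ee_affine_add ee_affine_mult Suc.IH) auto
  moreover have "ee_tableau z u r j (Suc k) =
      poly [:1 + c:] z * ee_tableau z u r j k + poly [:-c:] z * ee_tableau z u r (j - 1) k" for z u r
  proof -
    have "a + (a - b) / d = (1 + 1 / d) * a + - (1 / d) * b" for a b d :: complex
      by (simp add: algebra_simps diff_divide_distrib)
    then show ?thesis
      using Suc.hyps by (subst ee_tableau.simps) (simp add: c_def)
  qed
  ultimately show ?case by simp
qed

lemma ee_decomposition_exists: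
  assumes "p \<ge> 1"
  shows "\<exists>P Q. ee_decomposition p P Q"
  using ee_affine_tableau[of p p p] assms
  by (simp add: ee_affine_def ee_decomposition_def ee_step_def)

lemma ee_amplification_zero:
  "ee_amplification p {0} =
    (MAX m\<in>{1..p}. MAX l\<in>{1..m}. ereal (norm (poly (ee_internal_poly p m l) 0)))"
  by (simp add: ee_amplification_def)

lemma lambert_W_ex1:
  assumes "x \<ge> - exp (-1)"
  shows "\<exists>!w::real. w \<ge> -1 \<and> w * exp w = x"
proof -
  have mono: "a * exp a < b * exp b" if "-1 \<le> a" "a < b" for a b :: real
  proof (rule DERIV_pos_imp_increasing_open[OF that(2)])
    fix t assume t: "a < t" "t < b"
    have "((\<lambda>w. w * exp w) has_real_derivative (1 + t) * exp t) (at t)"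
      by (auto intro!: derivative_eq_intros simp: algebra_simps)
    moreover have "(1 + t) * exp t > 0"
      using \<open>-1 \<le> a\<close> t by simp
    ultimately show "\<exists>y. ((\<lambda>w. w * exp w) has_real_derivative y) (at t) \<and> y > 0"
      by blast
  qed (auto intro!: continuous_intros)
  let ?b = "max 0 x"
  have "x \<le> ?b * exp ?b"
    using mult_left_mono[of 1 "exp ?b" ?b] by simp
  moreover have "continuous_on {-1..?b} (\<lambda>w. w * exp w)"
    by (intro continuous_intros)
  ultimately obtain w where w: "-1 \<le> w" "w * exp w = x"
    using IVT'[of "\<lambda>w. w * exp w" "-1" x ?b] assms le_max_iff_disj[of "-1" 0 x] by auto
  show ?thesis
  proof (rule ex1I[of _ w])
    fix v assume v: "v \<ge> -1 \<and> v * exp v = x"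
    show "v = w"
      using mono[of v w] mono[of w v] v w by (cases v w rule: linorder_cases) auto
  qed (use w in simp)
qed

end

theory Submission
  imports Defs
begin

text \<open>
  At \<open>z = 0\<close> a stage merely adds up its residuals, so every residual of stage \<open>m\<close> enters the
  final value with the weight that the extrapolation gives to \<open>T\<^bsub>m,1\<^esub>\<close>. This is Aitken--Neville
  extrapolation to \<open>0\<close> from the nodes \<open>1/m\<close>, and the Lagrange weight of the node \<open>1/m\<close> has
  modulus \<open>m\<^sup>p / (m! (p - m)!)\<close> (\<open>norm_ee_internal_poly_0\<close>). The theorem thus is a bound on these
  numbers.

  Put \<open>q = p - m\<close>. If \<open>q > 0\<close>, Stirling's lower bound for both factorials
  (\<open>ln_fact_ge_stirling\<close>) bounds the weight by \<open>e\<^sup>p (m/q)\<^sup>q / (2 \<pi> sqrt (m q))\<close>. Here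
  \<open>m q \<ge> p - 1\<close>, and it remains to maximise \<open>(m/q)\<^sup>q\<close> for \<open>m + q = p\<close>. With \<open>w = W(1/e)\<close>, that is
  \<open>ln (1/w) = 1 + w\<close>, the inequality \<open>ln x \<le> x - 1\<close> at \<open>x = s w\<close> becomes the tangent estimate
  \<open>ln s \<le> w + s w\<close> (\<open>ln_le_lambert_W\<close>). At \<open>s = m/q\<close> it reads \<open>q ln (m/q) \<le> p w\<close>, so that
  \<open>e\<^sup>p (m/q)\<^sup>q \<le> e\<^bsup>p (1 + w)\<^esup> = (1/w)\<^sup>p\<close>. The constant \<open>1/w\<close> appears since the optimal ratio
  of \<open>m\<close> to \<open>q\<close> is \<open>1/w\<close>.

  For \<open>m = p\<close> there is just one factorial, and the claim reduces to
  \<open>2 \<pi> (p - 1) / p \<le> e\<^bsup>2 p w\<^esup>\<close>. As \<open>w \<ge> 1/4\<close>, the right-hand side is large enough from \<open>p = 3\<close> on.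
\<close>

section \<open>Stirling's lower bound\<close>

text \<open>The logarithm of \<open>n! e\<^sup>n / (n\<^sup>n sqrt n)\<close>, which Stirling's formula asserts to tend to
  \<open>ln (sqrt (2 \<pi>))\<close>.\<close>

definition stirling_defect :: "nat \<Rightarrow> real" where
  "stirling_defect n = ln (fact n) + real n - (real n + 1/2) * ln (real n)"

lemma stirling_defect_Suc:
  assumes "n > 0"
  shows "stirling_defect n - stirling_defect (Suc n)
       = (real n + 1/2) * (ln (real n + 1) - ln (real n)) - 1"
proof -
  have "ln (fact (Suc n)) = ln (real n + 1) + ln (fact n :: real)"
    by (simp add: ln_mult add.commute)
  then show ?thesis
    by (simp add: stirling_defect_def algebra_simps)
qed

text \<open>The midpoint rule underestimates the integral of the convex function \<open>1/x\<close> over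
  \<open>[n, n + 1]\<close>, whence \<open>ln (n + 1) - ln n \<ge> 1 / (n + 1/2)\<close>.\<close>

lemma stirling_defect_Suc_le:
  assumes "n > 0"
  shows "stirling_defect (Suc n) \<le> stirling_defect n"
proof -
  have "2 * 1 / (real n + (real n + 1)) \<le> ln (real n + 1) - ln (real n)"
    using ln_inverse_approx_ge[of "real n" "real n + 1"] assms by simp
  then have "(real n + 1/2) * (2 * 1 / (real n + (real n + 1)))
      \<le> (real n + 1/2) * (ln (real n + 1) - ln (real n))"
    by (intro mult_left_mono) auto
  moreover have "(real n + 1/2) * (2 * 1 / (real n + (real n + 1))) = 1"
    by (simp add: field_simps)
  ultimately show ?thesis
    using stirling_defect_Suc[OF assms] by linarith
qed

text \<open>The trapezoidal rule overestimates the same integral. The resulting bound on the decrease,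
  \<open>1 / (4 n (n + 1))\<close>, telescopes.\<close>

lemma stirling_defect_Suc_ge:
  assumes "n > 0"
  shows "stirling_defect n - 1 / (4 * real n)
       \<le> stirling_defect (Suc n) - 1 / (4 * real (Suc n))"
proof -
  have "ln (real n + 1) - ln (real n) \<le> (inverse (real n) + inverse (real n + 1)) / 2"
    using ln_inverse_approx_le[of "real n" 1] assms by simp
  then have "(real n + 1/2) * (ln (real n + 1) - ln (real n))
      \<le> (real n + 1/2) * ((inverse (real n) + inverse (real n + 1)) / 2)"
    by (intro mult_left_mono) auto
  moreover have "(real n + 1/2) * ((inverse (real n) + inverse (real n + 1)) / 2)
      = 1 + 1 / (4 * real n) - 1 / (4 * real (Suc n))"
    using assms by (simp add: divide_simps) (simp add: algebra_simps)
  ultimately show ?thesis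
    using stirling_defect_Suc[OF assms] by linarith
qed

lemma stirling_defect_antimono:
  assumes "0 < n" "n \<le> k"
  shows "stirling_defect k \<le> stirling_defect n"
  using assms(2)
proof (induction k rule: dec_induct)
  case (step k)
  then show ?case
    using stirling_defect_Suc_le[of k] assms(1) by linarith
qed simp

text \<open>The defects at \<open>n\<close> and \<open>2 n\<close> approach each other. The limit of
  \<open>2 stirling_defect n - stirling_defect (2 n)\<close>, which Wallis' product supplies, is therefore also
  the limit of \<open>stirling_defect\<close>.\<close>

lemma stirling_defect_double_close:
  assumes "0 < n"
  shows "stirling_defect n - stirling_defect (2 * n) \<le> 1 / (8 * real n)"
proof -
  have "stirling_defect n - 1 / (4 * real n) \<le> stirling_defect k - 1 / (4 * real k)"
    if "n \<le> k" for k
    using that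
  proof (induction k rule: dec_induct)
    case (step k)
    then show ?case
      using stirling_defect_Suc_ge[of k] assms by linarith
  qed simp
  from this[of "2 * n"]
  have "stirling_defect n - stirling_defect (2 * n) \<le> 1 / (4 * real n) - 1 / (4 * real (2 * n))"
    by simp
  also have "\<dots> = 1 / (8 * real n)"
    using assms by (simp add: field_simps)
  finally show ?thesis .
qed

lemma wallis_product_eq:
  "(\<Prod>k=1..n. (4 * real k ^ 2) / (4 * real k ^ 2 - 1))
     = 16 ^ n * fact n ^ 4 / (fact (2 * n) ^ 2 * (2 * real n + 1))"
proof (induction n)
  case (Suc n)
  define a :: real where "a = fact n"
  define b :: real where "b = fact (2 * n)"
  define x where "x = real n"
  have x: "x \<ge> 0" and ab: "a > 0" "b > 0"
    by (auto simp: a_def b_def x_def)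
  have f: "fact (Suc n) = (x + 1) * a" "fact (2 * Suc n) = (2 * x + 2) * (2 * x + 1) * b"
    by (simp_all add: a_def b_def x_def algebra_simps)
  have c: "4 * (x + 1) ^ 2 - 1 = (2 * x + 1) * (2 * x + 3)"
    by (simp add: power2_eq_square algebra_simps)
  have "(\<Prod>k=1..Suc n. (4 * real k ^ 2) / (4 * real k ^ 2 - 1))
      = 16 ^ n * a ^ 4 / (b ^ 2 * (2 * x + 1)) * (4 * (x + 1) ^ 2 / ((2 * x + 1) * (2 * x + 3)))"
    using Suc c by (simp add: a_def b_def x_def add.commute)
  also have "\<dots> = 16 ^ Suc n * ((x + 1) * a) ^ 4
      / (((2 * x + 2) * (2 * x + 1) * b) ^ 2 * (2 * real (Suc n) + 1))"
  proof -
    have "2 * real (Suc n) + 1 = 2 * x + 3" "2 * x + 2 = 2 * (x + 1)"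
      by (simp_all add: x_def)
    moreover have "A * a ^ 4 / (b ^ 2 * y) * (4 * u ^ 2 / (y * v))
        = (16 * A) * (u * a) ^ 4 / ((2 * u * y * b) ^ 2 * v)"
      if "u > 0" "y > 0" "v > 0" for A u v y :: real
      using that ab by (simp add: divide_simps power_mult_distrib) (simp add: power_numeral_reduce)
    ultimately show ?thesis
      using x by simp
  qed
  finally show ?case
    using f by simp
qed simp

text \<open>In this combination the terms \<open>n\<close> and \<open>n ln n\<close> of the defects cancel, and the factorials that
  are left are those of the Wallis product.\<close>

lemma stirling_defect_double_wallis:
  assumes "0 < n"
  shows "2 * stirling_defect n - stirling_defect (2 * n)
       = ln ((\<Prod>k=1..n. (4 * real k ^ 2) / (4 * real k ^ 2 - 1)) * (4 + 2 / real n)) / 2"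
proof -
  define x where "x = real n"
  have x: "x > 0" using assms by (simp add: x_def)
  define a :: real where "a = fact n"
  define b :: real where "b = fact (2 * n)"
  have ab: "a > 0" "b > 0"
    by (auto simp: a_def b_def)
  have l16: "ln (16 :: real) = 4 * ln 2"
    using ln_realpow[of 2 4] by simp
  have "4 + 2 / x = 2 * (2 * x + 1) / x"
    using x by (simp add: field_simps)
  then have "16 ^ n * a ^ 4 / (b ^ 2 * (2 * x + 1)) * (4 + 2 / x) = 2 * 16 ^ n * a ^ 4 / (b ^ 2 * x)"
    using x ab by (simp add: divide_simps)
  moreover have "ln (2 * 16 ^ n * a ^ 4 / (b ^ 2 * x))
      = ln 2 + x * (4 * ln 2) + 4 * ln a - (2 * ln b + ln x)"
    using x ab by (simp add: ln_mult ln_div ln_realpow l16 x_def)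
  ultimately show ?thesis
    using x ab unfolding wallis_product_eq stirling_defect_def
    by (simp add: ln_mult a_def[symmetric] b_def[symmetric] x_def[symmetric])
       (simp add: algebra_simps)
qed

lemma stirling_defect_tendsto: "stirling_defect \<longlonglongrightarrow> ln (2 * pi) / 2"
proof -
  have inv: "(\<lambda>n. c / real n) \<longlonglongrightarrow> 0" for c
    by (rule lim_const_over_n)
  have "(\<lambda>n. ln ((\<Prod>k=1..n. (4 * real k ^ 2) / (4 * real k ^ 2 - 1)) * (4 + 2 / real n)) / 2)
      \<longlonglongrightarrow> ln (pi / 2 * (4 + 0)) / 2"
    by (intro tendsto_intros wallis inv) auto
  then have "(\<lambda>n. ln ((\<Prod>k=1..n. (4 * real k ^ 2) / (4 * real k ^ 2 - 1)) * (4 + 2 / real n)) / 2)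
      \<longlonglongrightarrow> ln (2 * pi) / 2"
    by simp
  then have main: "(\<lambda>n. 2 * stirling_defect n - stirling_defect (2 * n)) \<longlonglongrightarrow> ln (2 * pi) / 2"
    using stirling_defect_double_wallis
    by (subst tendsto_cong[OF eventually_sequentiallyI[of 1]]) auto
  have "(\<lambda>n. stirling_defect n - stirling_defect (2 * n)) \<longlonglongrightarrow> 0"
  proof (rule tendsto_sandwich[OF _ _ tendsto_const inv[of "1/8"]])
    show "\<forall>\<^sub>F n in sequentially. 0 \<le> stirling_defect n - stirling_defect (2 * n)"
      by (auto intro!: eventually_sequentiallyI[of 1] stirling_defect_antimono)
    show "\<forall>\<^sub>F n in sequentially. stirling_defect n - stirling_defect (2 * n) \<le> 1 / 8 / real n"
      using stirling_defect_double_close by (auto intro!: eventually_sequentiallyI[of 1])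
  qed
  from tendsto_diff[OF main this] show ?thesis
    by simp
qed

text \<open>The defects decrease, so each of them is at least their limit.\<close>

theorem ln_fact_ge_stirling:
  assumes "n > 0"
  shows "ln (2 * pi * real n) / 2 + real n * ln (real n) - real n \<le> ln (fact n)"
proof -
  have "ln (2 * pi) / 2 \<le> stirling_defect n"
    using assms
    by (intro tendsto_upperbound[OF stirling_defect_tendsto] eventually_sequentiallyI[of n]
        stirling_defect_antimono) auto
  then show ?thesis
    using assms by (simp add: stirling_defect_def ln_mult algebra_simps add_divide_distrib)
qed

section \<open>The extrapolation weights\<close>

lemma ee_stage_unit_residual:
  "ee_stage 0 0 (\<lambda>i j. if i = m \<and> j = l then 1 else 0) n j
     = (if n = m \<and> 1 \<le> l \<and> l \<le> j then 1 else 0)"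
  by (induction j) auto

text \<open>The entry in row \<open>a + k\<close> and column \<open>k + 1\<close> extrapolates from the stages \<open>a, \<dots>, a + k\<close>; its
  dependence on stage \<open>m\<close> is the Lagrange weight, which is the product of \<open>m / (m - i)\<close> over the
  other stages \<open>i\<close> in this range. Indexing by the first stage \<open>a\<close> avoids truncated subtraction, and
  the binomial coefficient makes the weight vanish for \<open>m > a + k\<close>. With the sign \<open>(-1)\<^bsup>a + k + m\<^esup>\<close>
  factored out, the recursion of the tableau becomes the identity
  \<open>(a + k + 1) (k choose i - 1) + a (k choose i) = (a + i) (k + 1 choose i)\<close> for \<open>m = a + i\<close>.\<close>

lemma ee_tableau_unit_residual:
  assumes "1 \<le> l" "l \<le> m" "a \<ge> 1"
  shows "ee_tableau 0 0 (\<lambda>i j. if i = m \<and> j = l then 1 else 0) (a + k) (Suc k)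
    = (if a \<le> m then (-1) ^ (a + k + m) * of_nat (m ^ k * (k choose (m - a))) / fact k else 0)"
  (is "?T (a + k) (Suc k) = ?c a k")
  using assms(3)
proof (induction k arbitrary: a)
  case 0
  have "?T (a + 0) (Suc 0) = (if a = m then 1 else 0)"
    using assms(1,2) by (subst ee_tableau.simps) (auto simp: ee_stage_unit_residual)
  moreover have "(-1) ^ (m + m) = (1 :: complex)"
    by (simp flip: mult_2)
  ultimately show ?case
    by (auto simp: binomial_eq_0_iff)
next
  case (Suc k)
  have "?T (a + Suc k) (Suc (Suc k))
      = ?T (Suc a + k) (Suc k) + (?T (Suc a + k) (Suc k) - ?T (a + k) (Suc k))
        / (of_nat (a + Suc k) / (of_nat (a + Suc k) - of_nat (Suc (Suc k)) + 1) - 1)"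
    by (subst ee_tableau.simps) simp
  also have "\<dots> = ?c (Suc a) k + (?c (Suc a) k - ?c a k)
        / (of_nat (a + Suc k) / (of_nat (a + Suc k) - of_nat (Suc (Suc k)) + 1) - 1)"
    using Suc.IH[of "Suc a"] Suc.IH[of a] Suc.prems by (simp only:)
  also have "of_nat (a + Suc k) / (of_nat (a + Suc k) - of_nat (Suc (Suc k)) + 1) - 1
      = (of_nat (Suc k) / of_nat a :: complex)"
    using Suc.prems by (simp add: field_simps)
  also have "?c (Suc a) k + (?c (Suc a) k - ?c a k) / (of_nat (Suc k) / of_nat a)
      = (of_nat (a + Suc k) * ?c (Suc a) k - of_nat a * ?c a k) / of_nat (Suc k)"
    using Suc.prems by (simp add: divide_simps del: of_nat_Suc) (simp add: algebra_simps)
  also have "\<dots> = ?c a (Suc k)"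
  proof (cases "a \<le> m")
    case True
    then obtain i where i: "m = a + i"
      by (auto simp: le_iff_add)
    define s :: complex where "s = (-1) ^ (a + Suc k + m)"
    define P :: complex where "P = of_nat m ^ k"
    have s: "(-1) ^ (Suc a + k + m) = s" "(-1) ^ (a + k + m) = - s"
      by (simp_all add: s_def)
    show ?thesis
    proof (cases i)
      case 0
      then show ?thesis
        using i by (simp add: mult_ac del: of_nat_Suc)
    next
      case (Suc i')
      have "(a + Suc k) * (k choose i') + a * (k choose Suc i')
          = a * (Suc k choose Suc i') + Suc k * (k choose i')"
        by (simp add: algebra_simps)
      also have "\<dots> = m * (Suc k choose Suc i')"
        using Suc_times_binomial_eq[of k i'] i Suc by (simp add: algebra_simps del: binomial_Suc_Suc)
      finally have eq: "of_nat (a + Suc k) * of_nat (k choose i') + of_nat a * of_nat (k choose Suc i')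
          = (of_nat m * of_nat (Suc k choose Suc i') :: complex)"
        by (metis of_nat_add of_nat_mult)
      have "(of_nat (a + Suc k) * (s * (P * of_nat (k choose i')) / fact k)
            - of_nat a * (- s * (P * of_nat (k choose Suc i')) / fact k)) / of_nat (Suc k)
          = s * P * (of_nat (a + Suc k) * of_nat (k choose i') + of_nat a * of_nat (k choose Suc i'))
            / (fact (Suc k))"
        by (simp add: field_simps del: of_nat_Suc of_nat_add)
      also have "\<dots> = s * (of_nat m * P * of_nat (Suc k choose Suc i')) / fact (Suc k)"
        unfolding eq by (simp add: mult_ac)
      finally show ?thesis
        using i Suc True s by (simp add: P_def[symmetric] s_def[symmetric]
            del: of_nat_Suc fact_Suc of_nat_add binomial_Suc_Suc power_Suc)
           (simp add: P_def s_def)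
    qed
  qed auto
  finally show ?case .
qed

text \<open>The internal stability polynomials are read off by a unit perturbation of a single stage;
  the entry \<open>T\<^bsub>p,p\<^esub>\<close> corresponds to \<open>a = 1\<close> and \<open>k = p - 1\<close>.\<close>

lemma norm_ee_internal_poly_0:
  assumes "m \<in> {1..p}" "l \<in> {1..m}"
  shows "norm (poly (ee_internal_poly p m l) 0) = real m ^ p / (fact m * fact (p - m))"
proof -
  let ?r = "\<lambda>i j. if i = m \<and> j = l then 1 else (0::complex)"
  obtain P Q where d: "ee_decomposition p P Q"
    using ee_decomposition_exists[of p] assms by auto
  have "(\<Sum>i=1..p. \<Sum>j=1..i. poly (Q i j) 0 * ?r i j)
      = (\<Sum>i=1..p. if i = m then \<Sum>j=1..i. (if j = l then poly (Q i j) 0 else 0) else 0)"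
    by (intro sum.cong refl) (auto intro!: sum.cong simp del: sum.delta sum.delta')
  also have "\<dots> = poly (Q m l) 0"
    using assms by (simp add: sum.delta')
  finally have "poly (ee_internal_poly p m l) 0 = ee_step p 0 0 ?r"
    using d ee_internal_poly_eq[OF d assms] by (simp add: ee_decomposition_def)
  moreover obtain k where k: "p = Suc k"
    using assms by (cases p) auto
  moreover obtain m' where m': "m = Suc m'"
    using assms by (cases m) auto
  ultimately have "poly (ee_internal_poly p m l) 0
      = (-1) ^ (1 + k + m) * of_nat (m ^ k * (k choose m')) / fact k"
    using ee_tableau_unit_residual[of l m 1 k] assms by (simp add: ee_step_def)
  then have "norm (poly (ee_internal_poly p m l) 0) = real m ^ k * real (k choose m') / fact k"
    by (simp add: norm_divide norm_mult norm_power)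
  also have "real (k choose m') = fact k / (fact m' * fact (k - m'))"
    using assms k m' by (simp add: binomial_fact)
  finally show ?thesis
    by (simp add: k m' del: of_nat_Suc)
qed

section \<open>The constant \<open>W(1/e)\<close>\<close>

text \<open>The numerical bound needs no approximation of \<open>w\<close> itself: \<open>ln w + w\<close> increases in \<open>w\<close> and
  equals \<open>-1\<close>, so it suffices to compare it with its value at \<open>1 / 3.592\<close>.\<close>

lemma lambert_W_inv_e:
  defines "w \<equiv> lambert_W (1 / exp 1)"
  shows "w > 0" "ln w = - 1 - w" "1 / w < 3.592"
proof -
  have "1 / exp 1 \<ge> - exp (- 1 :: real)"
    by (rule order_trans[of _ 0]) auto
  from theI'[OF lambert_W_ex1[OF this]] have w: "w * exp w = 1 / exp 1"
    by (simp add: w_def lambert_W_def)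
  have "w * exp w > 0"
    unfolding w by simp
  then show pos: "w > 0"
    by (simp add: zero_less_mult_iff)
  have "ln (w * exp w) = -1"
    unfolding w by (simp add: ln_div)
  then show lnw: "ln w = - 1 - w"
    using pos by (simp add: ln_mult)
  (* The two sides are 1.27840 and 1.27871; six terms of the artanh series of the logarithm
     separate them. *)
  have num: "1 + 1 / 3.592 < ln (3.592 :: real)"
    using ln_approx_bounds[of "3.592" 6] by (simp add: eval_nat_numeral)
  show "1 / w < 3.592"
  proof (rule ccontr)
    assume "\<not> 1 / w < 3.592"
    then have le: "w \<le> 1 / 3.592"
      using pos by (simp add: field_simps)
    then have "ln w \<le> ln (1 / 3.592)"
      using pos by simp
    then show False
      using le lnw num by (simp add: ln_div)
  qed
qed

text \<open>The right-hand side is the tangent of the concave function \<open>ln\<close> at \<open>s = 1/w\<close>.\<close>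

lemma ln_le_lambert_W:
  fixes s :: real
  defines "w \<equiv> lambert_W (1 / exp 1)"
  assumes "s > 0"
  shows "ln s \<le> w + s * w"
proof -
  have "ln (s * w) \<le> s * w - 1"
    using assms lambert_W_inv_e(1) by (intro ln_le_minus_one) simp
  then show ?thesis
    using assms lambert_W_inv_e(1,2) by (simp add: ln_mult)
qed

section \<open>The bound on the weights\<close>

text \<open>For \<open>m = p\<close> the second factorial is \<open>0! = 1\<close> and contributes no factor
  \<open>sqrt (2 \<pi>)\<close> to the denominator. What makes up for it is that \<open>e\<^sup>p\<close>, the exponential
  growth at \<open>m = p\<close>, is smaller than \<open>(1/w)\<^sup>p\<close> by the factor \<open>e\<^bsup>p w\<^esup>\<close>.\<close>

lemma ln_weight_le:
  fixes p m :: nat and w :: real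
  defines "w \<equiv> lambert_W (1 / exp 1)"
  assumes "p \<ge> 3" "1 \<le> m" "m \<le> p"
  shows "p * ln (real m) - ln (fact m) - ln (fact (p - m))
       \<le> p * (1 + w) - ln (2 * pi) - ln (real p - 1) / 2"
proof (cases "m = p")
  case False
  define q where "q = p - m"
  have q: "q > 0" "p = m + q"
    using False assms by (auto simp: q_def)
  have "ln (real p - 1) \<le> ln (real m * real q)"
  proof -
    have "(real m - 1) * (real q - 1) \<ge> 0"
      using assms q by (intro mult_nonneg_nonneg) auto
    then show ?thesis
      using assms q by (subst ln_le_cancel_iff) (auto simp: algebra_simps)
  qed
  then have A: "ln (real p - 1) \<le> ln (real m) + ln (real q)"
    using assms q by (simp add: ln_mult)
  have "real q * ln (real m / real q) \<le> real q * (w + real m / real q * w)"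
    using assms q unfolding w_def by (intro mult_left_mono ln_le_lambert_W) auto
  then have "real q * (ln (real m) - ln (real q)) \<le> p * w"
    using assms q by (simp add: ln_div algebra_simps)
  with A show ?thesis
    using ln_fact_ge_stirling[of m] ln_fact_ge_stirling[of q] assms q
    by (simp add: ln_mult algebra_simps add_divide_distrib)
next
  case True
  have w: "w \<ge> 1 / 4"
    using lambert_W_inv_e(1,3) unfolding w_def by (simp add: field_simps)
  (* Since 2 p w is at least p/2, powers of exp (1/2) are a lower bound for exp (2 p w). *)
  have half: "exp (1 / 2) \<ge> (13 / 8 :: real)"
    using exp_lower_Taylor_quadratic[of "1/2"] by (simp add: power2_eq_square)
  have pi: "pi < 3.142"
    using pi_approx by simp
  have "2 * pi * (real p - 1) / p \<le> (13 / 8) ^ p"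
  (* For p = 3 the factor (p - 1) / p must be kept: (13/8)^3 is less than 2 pi. *)
  proof (cases "p = 3")
    case True
    then show ?thesis using pi by (simp add: eval_nat_numeral)
  next
    case False
    have "2 * pi * ((real p - 1) / p) \<le> 2 * pi * 1"
      using assms by (intro mult_left_mono) (auto simp: field_simps)
    also have "\<dots> \<le> (13 / 8) ^ 4"
      using pi by (simp add: eval_nat_numeral)
    also have "\<dots> \<le> (13 / 8) ^ p"
      using False assms by (intro power_increasing) auto
    finally show ?thesis by simp
  qed
  also have "\<dots> \<le> exp (1 / 2) ^ p"
    using half by (intro power_mono) auto
  also have "\<dots> = exp (p / 2)"
    by (simp flip: exp_of_nat_mult)
  also have "\<dots> \<le> exp (2 * (p * w))"
    using mult_left_mono[OF w, of "2 * real p"] by simp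
  finally have "ln (2 * pi * (real p - 1) / p) \<le> ln (exp (2 * (p * w)))"
    using assms by (subst ln_le_cancel_iff) auto
  then have "ln (2 * pi) + ln (real p - 1) - ln p \<le> 2 * (p * w)"
    using assms by (simp add: ln_mult ln_div)
  then show ?thesis
    using ln_fact_ge_stirling[of p] assms True by (simp add: ln_mult algebra_simps add_divide_distrib)
qed

lemma weight_le:
  fixes p m :: nat
  assumes "p \<ge> 3" "1 \<le> m" "m \<le> p"
  shows "real m ^ p / (fact m * fact (p - m))
       \<le> (1 / lambert_W (1 / exp 1)) ^ p / (2 * pi * sqrt (real p - 1))"
proof (subst ln_le_cancel_iff[symmetric])
  let ?w = "lambert_W (1 / exp 1)"
  have w: "?w > 0" "ln (1 / ?w) = 1 + ?w"
    using lambert_W_inv_e(1,2) by (auto simp: ln_div)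
  show "0 < real m ^ p / (fact m * fact (p - m))"
    using assms by simp
  show "0 < (1 / ?w) ^ p / (2 * pi * sqrt (real p - 1))"
    using assms w(1) by simp
  have "ln ((1 / ?w) ^ p / (2 * pi * sqrt (real p - 1)))
      = p * (1 + ?w) - (ln (2 * pi) + ln (real p - 1) / 2)"
    using assms w by (subst ln_div) (auto simp: ln_mult ln_realpow ln_sqrt simp del: power_one_over)
  moreover have "ln (real m ^ p / (fact m * fact (p - m)))
      = p * ln m - (ln (fact m) + ln (fact (p - m)))"
    using assms by (simp add: ln_div ln_mult ln_realpow)
  ultimately show "ln (real m ^ p / (fact m * fact (p - m)))
      \<le> ln ((1 / ?w) ^ p / (2 * pi * sqrt (real p - 1)))"
    using ln_weight_le[OF assms] by simp
qed

theorem theorem4p16: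
  fixes p :: nat
  assumes "p \<ge> 3"
  shows "ee_amplification p {0}
           \<le> ereal ((1 / lambert_W (1 / exp 1)) ^ p / (2 * pi * sqrt (real p - 1)))
       \<and> (1 / lambert_W (1 / exp 1)) ^ p / (2 * pi * sqrt (real p - 1))
           < 3.592 ^ p / (2 * pi * sqrt (real p - 1))"
proof
  show "ee_amplification p {0}
      \<le> ereal ((1 / lambert_W (1 / exp 1)) ^ p / (2 * pi * sqrt (real p - 1)))"
    unfolding ee_amplification_zero using assms
    by (auto simp: Max_le_iff norm_ee_internal_poly_0 intro!: weight_le)
  show "(1 / lambert_W (1 / exp 1)) ^ p / (2 * pi * sqrt (real p - 1))
      < 3.592 ^ p / (2 * pi * sqrt (real p - 1))"
    using assms lambert_W_inv_e(1,3)
    by (intro divide_strict_right_mono power_strict_mono) auto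
qed

end
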